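(* For every positive integer $n$, $$\sum_{k=1}^{n-1} \left(\frac{k}{3}\right) \frac{(-1)^k}{[k]_q}\, q^{\frac{k}{3}\left(k-\left(\frac{k}{3}\right)\right) - \frac{(k-1)(k-2)}{6}} \equiv \left(\frac{n}{3}\right) \frac{\left(\frac{n}{3}\right) - n}{6}\, q^{\frac{n^2-1}{3}} (1-q) \pmod{\Phi_n(q)}.$$
   Context: For an integer $m$, $\left(\frac{m}{3}\right)$ denotes the Legendre symbol modulo 3: it equals $1$ if $m\equiv 1 \pmod 3$, $-1$ if $m\equiv 2\pmod 3$, and $0$ if $3\mid m$. In the exponent, $\frac{k}{3}\left(k-\left(\frac{k}{3}\right)\right)$ means the rational number $k/3$ multiplied by $k$ minus the Legendre symbol $\left(\frac{k}{3}\right)$; all exponents occurring with a nonzero coefficient are integers (when $3\mid n$ the right-hand side is $0$). The $q$-integer is $[k]_q=(1-q^k)/(1-q)$. $\Phi_n(q)=\prod_{1\le k\le n,\ \gcd(n,k)=1}(q-e^{2\pi i k/n})$ is the $n$th cyclotomic polynomial. For rational functions $A(q),B(q)$ with rational coefficients whose denominators are coprime to $\Phi_n(q)$, $A\equiv B \pmod{\Phi_n(q)}$ means that the numerator of $A-B$ (in lowest terms) is divisible by $\Phi_n(q)$ in $\mathbb{Q}[q]$. *)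

theory Defs
  imports
    "HOL-Computational_Algebra.Computational_Algebra"
    "HOL-Computational_Algebra.Field_as_Ring"
    "HOL-Number_Theory.Number_Theory"
begin

definition complex_cyclotomic :: "nat \<Rightarrow> complex poly" where
  "complex_cyclotomic n =
     (\<Prod>k | k \<in> {1..n} \<and> coprime n k. [:- exp (2 * pi * \<i> * of_nat k / of_nat n), 1:])"

(* The complex product has rational coefficients for n > 0, so the description below is
   proper; this is the theorem map_poly_of_rat_cyclotomic. *)
definition cyclotomic :: "nat \<Rightarrow> rat poly" where
  "cyclotomic n = (THE p. map_poly of_rat p = complex_cyclotomic n)"

(* quot_of_fract yields the pair (numerator, denominator) in lowest terms. *)
definition cong_fract :: "rat poly fract \<Rightarrow> rat poly fract \<Rightarrow> rat poly \<Rightarrow> bool" where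
  "cong_fract A B P \<longleftrightarrow>
     coprime (snd (quot_of_fract A)) P \<and> coprime (snd (quot_of_fract B)) P \<and>
     P dvd fst (quot_of_fract (A - B))"

definition q_var :: "rat poly fract" where
  "q_var = Fract [:0, 1:] 1"

definition q_int :: "nat \<Rightarrow> rat poly fract" where
  "q_int k = (1 - q_var ^ k) / (1 - q_var)"

(* The integer value of k/3 * (k - (k/3)) - (k-1)(k-2)/6. Both divisions are exact unless
   3 dvd k (see q_exponent_exact); in that case the term has coefficient Legendre k 3 = 0. *)
definition q_exponent :: "int \<Rightarrow> int" where
  "q_exponent k = (k * (k - Legendre k 3)) div 3 - ((k - 1) * (k - 2)) div 6"

lemma Legendre_3: "Legendre k 3 = (if k mod 3 = 0 then 0 else if k mod 3 = 1 then 1 else - 1)"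
proof -
  have sq: "y\<^sup>2 mod 3 = 0 \<or> y\<^sup>2 mod 3 = 1" for y :: int
  proof -
    have "y mod 3 = 0 \<or> y mod 3 = 1 \<or> y mod 3 = 2" by presburger
    moreover have "y\<^sup>2 mod 3 = (y mod 3)\<^sup>2 mod 3" by (simp add: power_mod)
    ultimately show ?thesis by auto
  qed
  have "QuadRes 3 k" if "k mod 3 = 1"
    unfolding QuadRes_def cong_def using that by (intro exI[of _ 1]) auto
  moreover have "\<not> QuadRes 3 k" if "k mod 3 = 2"
    unfolding QuadRes_def cong_def using that sq by (metis zero_neq_numeral one_eq_numeral_iff num.distinct(1))
  moreover have "k mod 3 = 0 \<or> k mod 3 = 1 \<or> k mod 3 = 2" by presburger
  ultimately show ?thesis
    by (auto simp: Legendre_def cong_def)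
qed

lemma q_exponent_exact:
  assumes "\<not> 3 dvd k"
  shows "rat_of_int (q_exponent k) =
           of_int k / 3 * (of_int k - of_int (Legendre k 3)) - (of_int k - 1) * (of_int k - 2) / 6"
proof -
  have 1: "3 dvd k * (k - Legendre k 3)" and 2: "3 dvd (k - 1) * (k - 2)"
  proof -
    have "k mod 3 = 1 \<or> k mod 3 = 2" using assms by presburger
    then have "3 dvd (k - Legendre k 3) \<and> (3 dvd (k - 1) \<or> 3 dvd (k - 2))"
      unfolding Legendre_3 by auto presburger+
    then show "3 dvd k * (k - Legendre k 3)" and "3 dvd (k - 1) * (k - 2)"
      by auto
  qed
  have "2 dvd (k - 1) * (k - 2)" by simp
  then have "2 * 3 dvd (k - 1) * (k - 2)"
    using 2 by (intro divides_mult) auto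
  then have 3: "6 dvd (k - 1) * (k - 2)" by simp
  show ?thesis
    by (simp add: q_exponent_def 1 3 of_int_div)
qed

lemma map_poly_of_rat_add:
  "map_poly of_rat (p + q) = (map_poly of_rat p + map_poly of_rat q :: complex poly)"
  by (intro poly_eqI) (simp add: coeff_map_poly of_rat_add)

lemma map_poly_of_rat_mult:
  "map_poly of_rat (p * q) = (map_poly of_rat p * map_poly of_rat q :: complex poly)"
  by (intro poly_eqI) (simp add: coeff_map_poly coeff_mult of_rat_sum of_rat_mult)

lemma map_poly_of_rat_eq_iff:
  "map_poly of_rat p = (map_poly of_rat q :: complex poly) \<longleftrightarrow> p = q"
  by (metis (no_types, lifting) coeff_map_poly of_rat_0 of_rat_eq_iff poly_eqI)

lemma exp_root_of_unity: "exp (2 * pi * \<i> * of_nat k / of_nat n) = cis (2 * pi * real k / real n)"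
  by (simp add: cis_conv_exp mult_ac)

lemma prod_roots_of_unity:
  assumes "n > 0"
  shows "(\<Prod>z | z ^ n = 1. [:- z, 1:]) = (Polynomial.monom 1 n - 1 :: complex poly)"
proof -
  let ?p = "Polynomial.monom 1 n - 1 :: complex poly"
  have top: "Polynomial.coeff ?p n = 1"
    using assms by simp
  then have nz: "?p \<noteq> 0"
    by (metis Polynomial.coeff_0 zero_neq_one)
  have "degree ?p \<le> n"
    by (intro degree_diff_le) (auto simp: degree_monom_le)
  moreover have "n \<le> degree ?p"
    using top by (intro le_degree) simp
  ultimately have deg: "degree ?p = n" by simp
  have "lead_coeff ?p = 1"
    unfolding deg by (rule top)
  moreover have "rsquarefree ?p"
    unfolding rsquarefree_roots using assms
    by (auto simp: poly_monom pderiv_diff pderiv_monom power_0_left)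
  ultimately have "(\<Prod>z | poly ?p z = 0. [:- z, 1:]) = ?p"
    using complex_poly_decompose_rsquarefree[of ?p] by simp
  then show ?thesis by (simp add: poly_monom)
qed

lemma prod_complex_cyclotomic:
  assumes "n > 0"
  shows "(\<Prod>d | d dvd n. complex_cyclotomic d) = Polynomial.monom 1 n - 1"
proof -
  define f where "f k = cis (2 * pi * real k / real n)" for k
  have "bij_betw f {..<n} {z. z ^ n = 1}"
    unfolding f_def using bij_betw_roots_unity[OF assms] .
  then have "(\<Prod>k<n. [:- f k, 1:]) = Polynomial.monom 1 n - 1"
    unfolding prod_roots_of_unity[OF assms, symmetric] by (rule prod.reindex_bij_betw)
  moreover have "(\<Prod>k<n. [:- f k, 1:]) = (\<Prod>k\<in>{1..n}. [:- f k, 1:])"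
  proof -
    have "f 0 = f n" using assms by (simp add: f_def)
    moreover have "{..<n} = insert 0 {1..<n}" "{1..n} = insert n {1..<n}" using assms by auto
    ultimately show ?thesis by simp
  qed
  moreover have "(\<Prod>d | d dvd n. complex_cyclotomic d) =
      (\<Prod>d | d dvd n. \<Prod>k | k \<in> {1..n} \<and> n div gcd n k = d. [:- f k, 1:])"
  proof (rule prod.cong[OF refl])
    fix d assume "d \<in> {d. d dvd n}"
    then obtain e where n: "n = d * e" by auto
    with assms have "d > 0" "e > 0" by auto
    have "(\<Prod>k | k \<in> {1..n} \<and> n div gcd n k = d. [:- f k, 1:]) =
          (\<Prod>k | k \<in> {1..d} \<and> coprime d k. [:- f (k * e), 1:])"
    proof (rule prod.reindex_bij_witness[of _ "\<lambda>k. k * e" "\<lambda>k. k div e"])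
      fix k assume k: "k \<in> {k. k \<in> {1..n} \<and> n div gcd n k = d}"
      then have "n div gcd n k = d" by simp
      then have "n = d * gcd n k" using dvd_div_mult_self[OF gcd_dvd1, of n k] by simp
      then have e: "gcd n k = e" using n \<open>d > 0\<close> by simp
      then obtain j where j: "k = e * j" by (metis gcd_dvd2 dvdE)
      have "e * gcd d j = gcd n k"
        unfolding n j gcd_mult_distrib_nat by (simp only: mult.commute[of d])
      then have "e * gcd d j = e" using e by simp
      then have "coprime d j" using \<open>e > 0\<close> by (intro gcd_eq_1_imp_coprime) simp
      moreover have "j \<in> {1..d}" using k \<open>e > 0\<close> unfolding n j by (auto simp: mult.commute)
      ultimately show "k div e \<in> {k. k \<in> {1..d} \<and> coprime d k}"
        using j \<open>e > 0\<close> by simp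
      show "k div e * e = k" using j \<open>e > 0\<close> by simp
      then show "[:- f (k div e * e), 1:] = [:- f k, 1:]" by simp
    next
      fix k assume k: "k \<in> {k. k \<in> {1..d} \<and> coprime d k}"
      show "k * e div e = k" using \<open>e > 0\<close> by simp
      have "gcd n (k * e) = e * gcd d k"
        unfolding n gcd_mult_distrib_nat by (simp only: mult.commute[of e])
      then have "gcd n (k * e) = e" using k by simp
      then show "k * e \<in> {k. k \<in> {1..n} \<and> n div gcd n k = d}"
        using k \<open>e > 0\<close> unfolding n by auto
    qed
    also have "\<dots> = complex_cyclotomic d"
      unfolding complex_cyclotomic_def exp_root_of_unity f_def
      using \<open>e > 0\<close> by (simp add: n mult.assoc)
    finally show "complex_cyclotomic d =
        (\<Prod>k | k \<in> {1..n} \<and> n div gcd n k = d. [:- f k, 1:])" ..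
  qed
  moreover have "\<dots> = (\<Prod>k\<in>{1..n}. [:- f k, 1:])"
  proof -
    have "finite {d. d dvd n}" using assms by simp
    moreover have "(\<lambda>k. n div gcd n k) ` {1..n} \<subseteq> {d. d dvd n}"
      by (clarsimp, metis dvd_div_mult_self dvd_triv_left gcd_dvd1)
    ultimately show ?thesis
      using prod.group[of "{1..n}" "{d. d dvd n}" "\<lambda>k. n div gcd n k" "\<lambda>k. [:- f k, 1:]"] by simp
  qed
  ultimately show ?thesis by simp
qed

lemma complex_cyclotomic_nonzero: "complex_cyclotomic n \<noteq> 0"
  by (simp add: complex_cyclotomic_def)

lemma complex_cyclotomic_rational:
  assumes "n > 0"
  shows "\<exists>p. map_poly of_rat p = complex_cyclotomic n"
  using assms
proof (induction n rule: less_induct)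
  case (less n)
  have "\<exists>p. map_poly of_rat p = complex_cyclotomic d" if "d dvd n" "d \<noteq> n" for d
    using that less by (metis dvd_imp_le dvd_pos_nat order_le_neq_trans)
  then obtain c where c: "map_poly of_rat (c d) = complex_cyclotomic d" if "d dvd n" "d \<noteq> n" for d
    by metis
  define D where "D = {d. d dvd n} - {n}"
  have "finite D" using less.prems by (simp add: D_def)
  have "map_poly of_rat (\<Prod>d\<in>S. c d) = (\<Prod>d\<in>S. complex_cyclotomic d)" if "S \<subseteq> D" for S
    using finite_subset[OF that \<open>finite D\<close>] that
  proof (induction S rule: finite_induct)
    case empty
    show ?case by (simp add: one_pCons map_poly_pCons)
  next
    case (insert d S)
    then show ?case using c[of d] by (simp add: map_poly_of_rat_mult D_def)
  qed
  then have R: "map_poly of_rat (\<Prod>d\<in>D. c d) = (\<Prod>d\<in>D. complex_cyclotomic d)" by blast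
  define R where "R = (\<Prod>d\<in>D. c d)"
  define X where "X = (Polynomial.monom 1 n - 1 :: rat poly)"
  let ?m = "map_poly of_rat :: rat poly \<Rightarrow> complex poly"
  have "?m R \<noteq> 0"
    unfolding R_def R using \<open>finite D\<close> by (simp add: complex_cyclotomic_nonzero)
  have mX: "?m X = Polynomial.monom 1 n - 1"
    by (intro poly_eqI) (simp add: X_def coeff_map_poly of_rat_diff)
  have "insert n D = {d. d dvd n}" "n \<notin> D" by (auto simp: D_def)
  then have X: "?m X = complex_cyclotomic n * ?m R"
    using prod_complex_cyclotomic[OF less.prems] \<open>finite D\<close>
    unfolding mX R_def R by (metis prod.insert)
  have deg: "degree (?m p) = degree p" for p
    by (rule degree_map_poly) auto
  have "X = X div R * R + X mod R" by simp
  then have "?m X = ?m (X div R) * ?m R + ?m (X mod R)"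
    by (metis map_poly_of_rat_add map_poly_of_rat_mult)
  then have eq: "(complex_cyclotomic n - ?m (X div R)) * ?m R = ?m (X mod R)"
    unfolding X by (simp add: algebra_simps)
  have "complex_cyclotomic n - ?m (X div R) = 0"
  proof (rule ccontr)
    assume nz: "complex_cyclotomic n - ?m (X div R) \<noteq> 0"
    then have "?m (X mod R) \<noteq> 0" using eq \<open>?m R \<noteq> 0\<close> by (metis mult_eq_0_iff)
    then have "X mod R \<noteq> 0" by auto
    moreover have "degree R \<le> degree (X mod R)"
      using degree_mult_right_le[OF nz, of "?m R"] unfolding mult.commute[of "?m R"] eq deg .
    moreover have "R \<noteq> 0" using \<open>?m R \<noteq> 0\<close> by auto
    ultimately show False using degree_mod_less[of R X] by auto
  qed
  then show ?case by (intro exI[of _ "X div R"]) simp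
qed

theorem map_poly_of_rat_cyclotomic:
  assumes "n > 0"
  shows "map_poly of_rat (cyclotomic n) = complex_cyclotomic n"
proof -
  from complex_cyclotomic_rational[OF assms]
  obtain p where p: "map_poly of_rat p = complex_cyclotomic n" by blast
  then have "\<exists>!p. map_poly of_rat p = complex_cyclotomic n"
    by (metis map_poly_of_rat_eq_iff)
  then show ?thesis unfolding cyclotomic_def by (rule theI')
qed

end

theory Submission
  imports Defs
begin

text \<open>
  Both sides are evaluated at the primitive \<open>n\<close>-th roots of unity \<open>z\<close>, the simple roots of the
  cyclotomic polynomial. Writing \<open>k = \<bar>3 m + 1\<bar>\<close> turns the left-hand side into \<open>- (1 - z)\<close> times
  the truncated Appell sum of \<open>(- 1)^m z^(3 m (m + 1) / 2) / (1 - z^(3 m + 1))\<close> over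
  \<open>\<bar>3 m + 1\<bar> < n\<close>. If \<open>n = 3 d\<close>, the summand is antiperiodic with period \<open>d\<close> and the sum runs over
  two periods. Otherwise \<open>w = z^3\<close> is again a primitive root; centring the sum at its pole turns it into a
  multiple of \<open>\<Sum>s = 1..2 a. (- 1)^s w^(s (s + 1) / 2 - a s) / (1 - w^s)\<close>, up to the last term when
  \<open>n = 3 a - 1\<close>. By induction on \<open>a\<close>, this sum equals \<open>- (\<Sum>j = a + 1..2 a. 1 / (1 - w^j))\<close>, and the
  latter is evaluated by pairing \<open>j\<close> with \<open>n - j\<close>.
\<close>

section \<open>Truncated theta sums\<close>

definition triangular :: "int \<Rightarrow> int" where
  "triangular m = m * (m + 1) div 2"

text \<open>Consecutive integers have an even product, so the \<open>div\<close> is exact. Exponent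
  identities below are proved in doubled form to avoid it.\<close>

lemma two_triangular: "2 * triangular m = m * (m + 1)"
  by (simp add: triangular_def)

lemma sum_eq_0_if_antisymmetric:
  fixes f :: "nat \<Rightarrow> 'a :: field_char_0"
  assumes "\<And>s. s < N \<Longrightarrow> f (N - Suc s) = - f s"
  shows "(\<Sum>s<N. f s) = 0"
proof -
  have "(\<Sum>s<N. f s) = (\<Sum>s<N. f (N - Suc s))"
    by (rule sum.nat_diff_reindex[symmetric])
  also have "\<dots> = - (\<Sum>s<N. f s)"
    using assms by (simp add: sum_negf)
  finally show ?thesis by simp
qed

text \<open>The exponent is negative for \<open>0 < s < 2 * a - 1\<close>, hence
  \<open>powi\<close>. The linear part \<open>a s\<close> is what a triangular exponent leaves
  behind when it is centred at a pole.\<close>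

definition theta_term :: "'a :: field \<Rightarrow> nat \<Rightarrow> nat \<Rightarrow> 'a" where
  "theta_term w a s = (- 1) ^ s * w powi (triangular (int s) - int a * int s)"

text \<open>Drives the induction on \<open>a\<close>: raising \<open>a\<close> by one changes the
  quotient by \<open>1 - w ^ s\<close> by exactly \<open>theta_term w (Suc a) s\<close>, which has
  no denominator.\<close>

lemma theta_term_Suc:
  assumes "w \<noteq> 0"
  shows "theta_term w a s = theta_term w (Suc a) s * w ^ s"
proof -
  have "triangular (int s) - int a * int s = (triangular (int s) - int (Suc a) * int s) + int s"
    by (simp add: algebra_simps)
  then have "w powi (triangular (int s) - int a * int s)
      = w powi (triangular (int s) - int (Suc a) * int s) * w ^ s"
    using assms by (metis power_int_add power_int_of_nat)
  then show ?thesis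
    unfolding theta_term_def by simp
qed

lemma theta_term_eq:
  assumes "int s * (int s + 1) - 2 * int a * int s = 2 * int e"
  shows "theta_term w a s = (- 1) ^ s * w ^ e"
proof -
  have "triangular (int s) - int a * int s = int e"
    using assms two_triangular[of "int s"] by simp
  then show ?thesis by (simp add: theta_term_def)
qed

lemma theta_term_last: "theta_term w a (2 * a) = w ^ a"
  by (subst theta_term_eq[where e = a]) (auto simp: algebra_simps)

text \<open>The reflection of \<open>s\<close> to \<open>2 * a - 1 - s\<close> preserves the
  exponent and flips the sign, so the terms with \<open>s < 2 * a\<close> cancel. Moving this window
  by one trades the term 1 at \<open>s = 0\<close> for \<open>w ^ a\<close> at
  \<open>s = 2 * a\<close>.\<close>

lemma sum_theta_term:
  fixes w :: "'a :: field_char_0"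
  shows "(\<Sum>s = 1..2 * a. theta_term w a s) = w ^ a - 1"
proof (cases a)
  case (Suc b)
  have "(\<Sum>s<2 * a. theta_term w a s) = 0"
  proof (rule sum_eq_0_if_antisymmetric)
    fix s assume s: "s < 2 * a"
    define t where "t = 2 * a - Suc s"
    have t: "int t = 2 * int a - 1 - int s" using s by (simp add: t_def)
    have "2 * (triangular (int t) - int a * int t) = 2 * (triangular (int s) - int a * int s)"
      unfolding right_diff_distrib two_triangular t by (simp add: algebra_simps)
    then have "triangular (int t) - int a * int t = triangular (int s) - int a * int s" by simp
    moreover have "even t \<longleftrightarrow> odd s" using s by (simp add: t_def)
    ultimately show "theta_term w a (2 * a - Suc s) = - theta_term w a s"
      unfolding t_def[symmetric] theta_term_def by (simp add: minus_one_power_iff)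
  qed
  moreover have "(\<Sum>s = 1..2 * a. theta_term w a s)
      = (\<Sum>s<2 * a. theta_term w a s) + theta_term w a (2 * a) - theta_term w a 0"
  proof -
    have "{..2 * a} = insert 0 {1..2 * a}" by auto
    then have "(\<Sum>s\<le>2 * a. theta_term w a s) = theta_term w a 0 + (\<Sum>s = 1..2 * a. theta_term w a s)"
      by simp
    moreover have "(\<Sum>s\<le>2 * a. theta_term w a s) = (\<Sum>s<2 * a. theta_term w a s) + theta_term w a (2 * a)"
      by (simp add: lessThan_Suc_atMost[symmetric])
    ultimately show ?thesis by (simp add: algebra_simps)
  qed
  ultimately show ?thesis
    by (simp add: theta_term_last) (simp add: theta_term_def triangular_def)
qed simp

text \<open>Factor \<open>1 - x ^ (2 * k)\<close> as \<open>(1 - x ^ k) * (1 + x ^ k)\<close> and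
  write \<open>x ^ k\<close> as \<open>(1 + x ^ k) - 1\<close>.\<close>

lemma geometric_split:
  fixes x :: "'a :: field"
  assumes "x ^ (2 * k) \<noteq> 1"
  shows "x ^ k / (1 - x ^ (2 * k)) = 1 / (1 - x ^ k) - 1 / (1 - x ^ (2 * k))"
proof -
  have "1 - x ^ (2 * k) = (1 - x ^ k) * (1 + x ^ k)"
    unfolding power_even_eq power2_eq_square by (simp add: algebra_simps)
  moreover have "1 - x ^ (2 * k) \<noteq> 0" using assms by simp
  ultimately have "1 / (1 - x ^ k) = (1 + x ^ k) / (1 - x ^ (2 * k))"
    by (simp add: divide_simps)
  then show ?thesis by (simp flip: diff_divide_distrib)
qed

text \<open>Serves the terms whose denominator contains a negative power; \<open>x\<close> will be
  \<open>w ^ s\<close> or \<open>z ^ k\<close>.\<close>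

lemma divide_one_minus_inverse:
  fixes x :: "'a :: field"
  assumes "x \<noteq> 0" "x \<noteq> 1"
  shows "c / x / (1 - 1 / x) = - (c / (1 - x))"
  using assms by (simp add: divide_simps) (simp add: algebra_simps)

text \<open>The induction step contributes the closed sum \<open>w ^ Suc a - 1\<close> and the two
  new terms \<open>s = 2 * a + 1\<close> and \<open>s = 2 * Suc a\<close>. Together they move the
  window of reciprocals from \<open>a + 1..2 * a\<close> to \<open>a + 2..2 * a + 2\<close>.\<close>

lemma sum_theta_quotient:
  fixes w :: "'a :: field_char_0"
  assumes "w \<noteq> 0" and "\<And>s. 1 \<le> s \<Longrightarrow> s \<le> 2 * a \<Longrightarrow> w ^ s \<noteq> 1"
  shows "(\<Sum>s = 1..2 * a. theta_term w a s / (1 - w ^ s)) = - (\<Sum>j = a + 1..2 * a. 1 / (1 - w ^ j))"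
  using assms(2)
proof (induction a)
  case (Suc a)
  let ?t = "theta_term w" and ?h = "\<lambda>j. 1 / (1 - w ^ j)"
  let ?b = "Suc a"
  have nz: "1 - w ^ s \<noteq> 0" if "1 \<le> s" "s \<le> 2 * ?b" for s
    using Suc.prems[OF that] by simp
  have "(\<Sum>s = 1..2 * ?b. ?t ?b s / (1 - w ^ s)) = (\<Sum>s = 1..2 * ?b. ?t a s / (1 - w ^ s) + ?t ?b s)"
  proof (rule sum.cong[OF refl])
    fix s assume "s \<in> {1..2 * ?b}"
    then have "1 - w ^ s \<noteq> 0" by (intro nz) auto
    then show "?t ?b s / (1 - w ^ s) = ?t a s / (1 - w ^ s) + ?t ?b s"
      unfolding theta_term_Suc[OF assms(1), of a] by (simp add: field_simps)
  qed
  also have "\<dots> = (\<Sum>s = 1..2 * a. ?t a s / (1 - w ^ s)) + ?t a (2 * a + 1) / (1 - w ^ (2 * a + 1))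
      + ?t a (2 * ?b) / (1 - w ^ (2 * ?b)) + (w ^ ?b - 1)"
    unfolding sum.distrib sum_theta_term by simp
  also have "(\<Sum>s = 1..2 * a. ?t a s / (1 - w ^ s)) = - (\<Sum>j = a + 1..2 * a. ?h j)"
    using Suc by simp
  \<comment> \<open>The exponent for parameter \<open>a\<close> is
    \<open>s (s + 1 - 2 a) / 2\<close>: it equals \<open>s\<close> at \<open>s = 2 * a + 1\<close>
    and \<open>3 * Suc a\<close> at \<open>s = 2 * Suc a\<close>.\<close>
  also have "?t a (2 * a + 1) = - (w ^ (2 * a + 1))"
    by (subst theta_term_eq[where e = "2 * a + 1"]) (auto simp: algebra_simps)
  also have "?t a (2 * ?b) = w ^ ?b * w ^ (2 * ?b)"
  proof -
    have "?t a (2 * ?b) = w ^ (3 * ?b)"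
      by (subst theta_term_eq[where e = "3 * ?b"]) (auto simp: algebra_simps)
    also have "3 * ?b = ?b + 2 * ?b" by simp
    finally show ?thesis by (simp only: power_add)
  qed
  also have "- (w ^ (2 * a + 1)) / (1 - w ^ (2 * a + 1)) = 1 - ?h (2 * a + 1)"
    using nz[of "2 * a + 1"] by (simp add: field_simps)
  also have "w ^ ?b * w ^ (2 * ?b) / (1 - w ^ (2 * ?b)) = w ^ ?b / (1 - w ^ (2 * ?b)) - w ^ ?b"
    using nz[of "2 * ?b"] by (simp add: field_simps)
  also have "w ^ ?b / (1 - w ^ (2 * ?b)) = ?h ?b - ?h (2 * ?b)"
    using Suc.prems[of "2 * ?b"] by (intro geometric_split) simp
  \<comment> \<open>The constants and the powers \<open>w ^ ?b\<close> cancel; the surviving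
    \<open>?h ?b\<close> removes the lower end of the window.\<close>
  also have "- (\<Sum>j = a + 1..2 * a. ?h j) + (1 - ?h (2 * a + 1)) + (?h ?b - ?h (2 * ?b) - w ^ ?b) + (w ^ ?b - 1)
      = - ((\<Sum>j = a + 1..2 * a. ?h j) + ?h (2 * a + 1) + ?h (2 * ?b) - ?h ?b)"
    by (simp add: algebra_simps)
  also have "(\<Sum>j = a + 1..2 * a. ?h j) + ?h (2 * a + 1) + ?h (2 * ?b) = (\<Sum>j = ?b..2 * ?b. ?h j)"
    by simp
  also have "\<dots> - ?h ?b = (\<Sum>j = ?b + 1..2 * ?b. ?h j)"
    by (subst sum.atLeast_Suc_atMost[of ?b]) auto
  finally show ?case .
qed simp

section \<open>Indices prime to 3 as \<open>\<bar>3 m + 1\<bar>\<close>\<close>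

lemma bij_betw_nat_abs_3m_1:
  "bij_betw (\<lambda>m. nat \<bar>3 * m + 1\<bar>) {m. \<bar>3 * m + 1\<bar> < int n} {k \<in> {1..n - 1}. \<not> 3 dvd k}"
proof (rule bij_betw_imageI)
  show "inj_on (\<lambda>m :: int. nat \<bar>3 * m + 1\<bar>) {m. \<bar>3 * m + 1\<bar> < int n}"
  proof (rule inj_onI)
    fix m m' :: int assume "nat \<bar>3 * m + 1\<bar> = nat \<bar>3 * m' + 1\<bar>"
    then have "3 * m + 1 = 3 * m' + 1 \<or> 3 * m + 1 = - (3 * m' + 1)"
      by (simp only: eq_nat_nat_iff abs_ge_zero abs_eq_iff)
    \<comment> \<open>The second alternative would give \<open>3 * (m + m') = - 2\<close>.\<close>
    then show "m = m'" by presburger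
  qed
  show "(\<lambda>m. nat \<bar>3 * m + 1\<bar>) ` {m. \<bar>3 * m + 1\<bar> < int n} = {k \<in> {1..n - 1}. \<not> 3 dvd k}" (is "?f ` ?M = ?K")
  proof (intro equalityI subsetI)
    fix k assume "k \<in> ?f ` ?M"
    then obtain m where m: "\<bar>3 * m + 1\<bar> < int n" "k = nat \<bar>3 * m + 1\<bar>" by blast
    have "\<not> 3 dvd 3 * m + 1" by presburger
    then have "\<not> 3 dvd k" by (simp add: m dvd_nat_abs_iff)
    moreover from this have "0 < k" by (intro gr0I) simp
    moreover have "k < n" using m by linarith
    ultimately show "k \<in> ?K" by simp
  next
    fix k assume k: "k \<in> ?K"
    define i where "i = int (k div 3)"
    have "k mod 3 \<noteq> 0" using k by (simp add: dvd_eq_mod_eq_0)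
    moreover have "k mod 3 < 3" by simp
    moreover have "k = 3 * (k div 3) + k mod 3" by simp
    ultimately have "int k = 3 * i + 1 \<or> int k = 3 * i + 2" unfolding i_def by linarith
    \<comment> \<open>Residue 2 comes from negative \<open>m\<close>, since
      \<open>3 * (- i - 1) + 1 = - (3 * i + 2)\<close>.\<close>
    then have "\<bar>3 * i + 1\<bar> = int k \<or> \<bar>3 * (- i - 1) + 1\<bar> = int k"
      unfolding i_def by auto
    then obtain m where m: "\<bar>3 * m + 1\<bar> = int k" by blast
    show "k \<in> ?f ` ?M"
    proof (rule image_eqI)
      show "k = ?f m" using m by simp
      show "m \<in> ?M" using m k by auto
    qed
  qed
qed

section \<open>Primitive roots of unity\<close>

definition primitive_root_of_unity :: "nat \<Rightarrow> 'a :: field_char_0 \<Rightarrow> bool" where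
  "primitive_root_of_unity n z \<longleftrightarrow> n > 0 \<and> z ^ n = 1 \<and> (\<forall>j. 0 < j \<longrightarrow> j < n \<longrightarrow> z ^ j \<noteq> 1)"

text \<open>A summand of Appell-Lerch type whose theta part is in \<open>z ^ 3\<close>. As
  \<open>m\<close> takes both signs, one formula covers the residues 1 and 2 modulo 3.\<close>

definition appell_term :: "'a :: field_char_0 \<Rightarrow> int \<Rightarrow> 'a" where
  "appell_term z m = (- 1) powi m * z powi (3 * triangular m) / (1 - z powi (3 * m + 1))"

context
  fixes n :: nat and z :: "'a :: field_char_0"
  assumes prim: "primitive_root_of_unity n z"
begin

lemma primitive_root_pos: "n > 0"
  and primitive_root_power_order: "z ^ n = 1"
  and primitive_root_power_neq_1: "0 < j \<Longrightarrow> j < n \<Longrightarrow> z ^ j \<noteq> 1"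
  using prim by (auto simp: primitive_root_of_unity_def)

lemma primitive_root_nonzero: "z \<noteq> 0"
  using primitive_root_power_order primitive_root_pos by (metis power_0_left zero_neq_one less_numeral_extra(3))

lemma primitive_root_powi_eq_1_iff: "z powi j = 1 \<longleftrightarrow> int n dvd j"
proof -
  have "z powi j = z powi (int n * (j div int n) + j mod int n)" by simp
  also have "\<dots> = z powi (j mod int n)"
    by (subst power_int_add) (simp_all add: primitive_root_nonzero power_int_mult primitive_root_power_order)
  also have "\<dots> = z ^ nat (j mod int n)"
    using primitive_root_pos by (simp add: power_int_nonneg_exp)
  finally have *: "z powi j = z ^ nat (j mod int n)" .
  show ?thesis
  proof
    assume "z powi j = 1"
    moreover have "nat (j mod int n) < n"
      using primitive_root_pos pos_mod_bound[of "int n" j] pos_mod_sign[of "int n" j] by linarith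
    ultimately have "nat (j mod int n) = 0"
      unfolding * using primitive_root_power_neq_1 by blast
    then show "int n dvd j"
      using primitive_root_pos pos_mod_sign[of "int n" j] by (simp add: dvd_eq_mod_eq_0 del: pos_mod_sign)
  qed (simp add: * dvd_eq_mod_eq_0)
qed

lemma primitive_root_power_eq_1_iff: "z ^ j = 1 \<longleftrightarrow> n dvd j"
  using primitive_root_powi_eq_1_iff[of "int j"] by simp

lemma primitive_root_powi_cong: "int n dvd i - j \<Longrightarrow> z powi i = z powi j"
  using primitive_root_powi_eq_1_iff[of "i - j"] primitive_root_nonzero by (simp add: power_int_diff)

text \<open>For odd \<open>n\<close>, \<open>r\<close> is even and \<open>e\<close> is a multiple of
  \<open>n\<close>; for even \<open>n\<close>, \<open>z ^ (n / 2)\<close> is the square root of 1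
  other than 1. The parity condition merges both cases into one sign rule.\<close>

lemma primitive_root_powi_half:
  assumes "odd r \<longleftrightarrow> even n" "2 * e = r * int n"
  shows "z powi e = (- 1) powi r"
proof (cases "even r")
  case True
  then obtain t where "r = 2 * t" by auto
  then have "e = int n * t" using assms(2) by simp
  then show ?thesis using True by (simp add: power_int_mult primitive_root_power_order power_int_minus_left)
next
  case False
  then obtain h where h: "n = 2 * h" using assms(1) by auto
  then have "h > 0" "h < n" using primitive_root_pos by auto
  have "(z ^ h)\<^sup>2 = 1" using primitive_root_power_order by (simp add: h mult.commute flip: power_mult)
  then have "z ^ h = - 1" using primitive_root_power_neq_1[OF \<open>h > 0\<close> \<open>h < n\<close>] by (simp add: power2_eq_1_iff)
  moreover have "e = int h * r" using assms(2) h by simp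
  ultimately show ?thesis by (simp add: power_int_mult)
qed

text \<open>Applied with \<open>d = 3\<close>, so that the results on primitive roots hold for
  \<open>w = z ^ 3\<close> too.\<close>

lemma primitive_root_power:
  assumes "coprime n d"
  shows "primitive_root_of_unity n (z ^ d)"
  unfolding primitive_root_of_unity_def
proof (intro conjI allI impI)
  show "(z ^ d) ^ n = 1" by (simp add: power_mult[symmetric] primitive_root_power_eq_1_iff)
  show "(z ^ d) ^ j \<noteq> 1" if "0 < j" "j < n" for j
    using that assms unfolding power_mult[symmetric] primitive_root_power_eq_1_iff
    by (metis coprime_dvd_mult_right_iff nat_dvd_not_less)
qed (rule primitive_root_pos)

text \<open>Since \<open>a + b = n\<close>, the interval is stable under \<open>j\<close> to
  \<open>n - j\<close>, and paired terms add up to 1 because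
  \<open>1 / (1 - x) + 1 / (1 - 1 / x) = 1\<close>.\<close>

lemma primitive_root_sum_inverse:
  assumes "0 < a" "b < n" "a + b = n"
  shows "(\<Sum>j = a..b. 1 / (1 - z ^ j)) = of_nat (card {a..b}) / 2"
proof -
  let ?S = "\<Sum>j = a..b. 1 / (1 - z ^ j)"
  have "?S = (\<Sum>j = a..b. 1 / (1 - z ^ (n - j)))"
    using sum.atLeastAtMost_rev[of "\<lambda>j. 1 / (1 - z ^ j)" a b] assms by (simp add: add.commute)
  then have "?S + ?S = (\<Sum>j = a..b. 1 / (1 - z ^ j) + 1 / (1 - z ^ (n - j)))"
    by (simp add: sum.distrib)
  also have "\<dots> = (\<Sum>j = a..b. 1)"
  proof (rule sum.cong[OF refl])
    fix j assume "j \<in> {a..b}"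
    then have j: "0 < j" "j < n" using assms by auto
    have "z ^ (n - j) = 1 / z ^ j"
      using power_diff[OF primitive_root_nonzero, of j n] j primitive_root_power_order by simp
    moreover have "z ^ j \<noteq> 1" "z ^ j \<noteq> 0" using primitive_root_power_neq_1 j primitive_root_nonzero by auto
    moreover have "1 / (1 - x) + 1 / (1 - 1 / x) = 1" if "x \<noteq> 1" "x \<noteq> 0" for x :: 'a
      using that by (simp add: divide_simps) (simp add: algebra_simps)
    ultimately show "1 / (1 - z ^ j) + 1 / (1 - z ^ (n - j)) = 1" by presburger
  qed
  finally have "?S + ?S = of_nat (card {a..b})" by simp
  then show ?thesis by (simp add: field_simps)
qed

end

section \<open>The truncated Appell sum at a primitive root\<close>

context
  fixes n :: nat and z :: "'a :: field_char_0"
  assumes prim: "primitive_root_of_unity n z"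
begin

text \<open>Shifting \<open>m\<close> by \<open>d\<close> changes \<open>3 * m + 1\<close> by
  \<open>n\<close>, so the denominator is unchanged. The sign contributes \<open>(- 1) ^ d\<close>
  and the theta power \<open>(- 1) ^ (d + 1)\<close>, so the two periods cancel.\<close>

lemma appell_sum_0_mod_3:
  assumes "n = 3 * d"
  shows "(\<Sum>m \<in> {- int d..int d - 1}. appell_term z m) = 0"
proof -
  have shift: "appell_term z (m - int d) = - appell_term z m" for m
  proof -
    \<comment> \<open>The exponents differ by a half-integral multiple of \<open>n\<close>, and
      \<open>n = 3 * d\<close> has the parity of \<open>d\<close>, which is the situation of
      \<open>primitive_root_powi_half\<close>.\<close>
    have "2 * (3 * triangular m - 3 * triangular (m - int d)) = (2 * m - int d + 1) * int n"
      unfolding right_diff_distrib mult.left_commute[of 2] two_triangular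
      by (simp add: assms algebra_simps)
    moreover have "odd (2 * m - int d + 1) \<longleftrightarrow> even n" by (simp add: assms)
    ultimately have "z powi (3 * triangular m - 3 * triangular (m - int d)) = (- 1) powi (2 * m - int d + 1)"
      by (intro primitive_root_powi_half[OF prim]) auto
    then have "z powi (3 * triangular m) = (- 1) powi (2 * m - int d + 1) * z powi (3 * triangular (m - int d))"
      using primitive_root_nonzero[OF prim] by (simp add: power_int_diff field_simps)
    moreover have "z powi (3 * (m - int d) + 1) = z powi (3 * m + 1)"
      by (rule primitive_root_powi_cong[OF prim]) (simp add: assms)
    ultimately show ?thesis
      unfolding appell_term_def by (simp add: power_int_minus_left)
  qed
  have "(\<Sum>m \<in> {- int d..int d - 1}. appell_term z m)
      = (\<Sum>m \<in> {- int d..-1}. appell_term z m) + (\<Sum>m \<in> {0..int d - 1}. appell_term z m)"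
    by (subst sum.union_disjoint[symmetric]) (auto intro!: sum.cong)
  also have "(\<Sum>m \<in> {- int d..-1}. appell_term z m) = (\<Sum>m \<in> {0..int d - 1}. appell_term z (m - int d))"
    by (rule sum.reindex_bij_witness[of _ "\<lambda>m. m - int d" "\<lambda>m. m + int d"]) auto
  finally show ?thesis by (simp add: shift sum_negf)
qed

text \<open>With \<open>m = r - s\<close>, \<open>3 * m + 1\<close> is \<open>n - 3 * s\<close>: the
  excluded pole \<open>3 * m + 1 = n\<close> is \<open>s = 0\<close>, and the denominator becomes
  \<open>1 - 1 / w ^ s\<close>. The numerator exponent is \<open>triangular r\<close> plus that of
  \<open>theta_term w r s\<close>, minus \<open>s\<close>; the resulting factor
  \<open>1 / w ^ s\<close> clears the inverse.\<close>

lemma appell_sum_1_mod_3: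
  assumes "n = 3 * r + 1"
  shows "(\<Sum>m \<in> {- int r..int r - 1}. appell_term z m)
     = of_nat r / 2 * z powi (((int n)\<^sup>2 - 1) div 3)"
proof -
  define w where "w = z ^ 3"
  have "coprime n 3"
    unfolding assms Suc_eq_plus1[symmetric]
    by (metis coprime_Suc_right_nat coprime_commute coprime_mult_left_iff)
  then have prim_w: "primitive_root_of_unity n w"
    unfolding w_def by (rule primitive_root_power[OF prim])
  have "appell_term z (int r - int s) = - ((- 1) ^ r * w powi (triangular (int r))) * (theta_term w r s / (1 - w ^ s))"
    if "s \<in> {1..2 * r}" for s
  proof -
    have "2 * (triangular (int r - int s) + int s) = 2 * (triangular (int r) + (triangular (int s) - int r * int s))"
      unfolding right_diff_distrib distrib_left two_triangular by (simp add: algebra_simps)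
    then have "triangular (int r - int s) + int s = triangular (int r) + (triangular (int s) - int r * int s)"
      by simp
    then have "w powi triangular (int r - int s) * w ^ s = w powi (triangular (int r)) * w powi (triangular (int s) - int r * int s)"
      using primitive_root_nonzero[OF prim_w] by (metis power_int_add power_int_of_nat)
    then have "w powi triangular (int r - int s) = w powi (triangular (int r)) * w powi (triangular (int s) - int r * int s) / w ^ s"
      using primitive_root_nonzero[OF prim_w] by (simp add: field_simps)
    moreover have "z powi (3 * (int r - int s) + 1) = 1 / w ^ s"
    proof -
      have "z powi (3 * (int r - int s) + 1) = z powi (- (3 * int s))"
        by (rule primitive_root_powi_cong[OF prim]) (simp add: assms add.commute)
      then show ?thesis
        by (simp add: power_int_minus_divide power_int_mult w_def)
    qed
    moreover have "((- 1) :: 'a) powi (int r - int s) = (- 1) ^ r * (- 1) ^ s"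
      by (simp add: power_int_minus_left minus_one_power_iff)
    ultimately have "appell_term z (int r - int s)
        = (- 1) ^ r * w powi (triangular (int r)) * theta_term w r s / w ^ s / (1 - 1 / w ^ s)"
      unfolding appell_term_def theta_term_def power_int_mult
      by (simp add: w_def[symmetric])
    moreover have "w ^ s \<noteq> 1" "w ^ s \<noteq> 0"
      using that primitive_root_power_neq_1[OF prim_w, of s] primitive_root_nonzero[OF prim_w] assms by auto
    ultimately show ?thesis
      by (subst (asm) divide_one_minus_inverse) simp_all
  qed
  then have "(\<Sum>s = 1..2 * r. appell_term z (int r - int s)) =
      - ((- 1) ^ r * w powi (triangular (int r))) * (\<Sum>s = 1..2 * r. theta_term w r s / (1 - w ^ s))"
    by (simp add: sum_distrib_left)
  \<comment> \<open>The window \<open>r + 1..2 * r\<close> has \<open>r\<close> elements and is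
    symmetric because its ends add up to \<open>n\<close>.\<close>
  also have "(\<Sum>s = 1..2 * r. theta_term w r s / (1 - w ^ s)) = - (of_nat r / 2)"
    using primitive_root_nonzero[OF prim_w] primitive_root_power_neq_1[OF prim_w] assms
    by (subst sum_theta_quotient) (auto simp: primitive_root_sum_inverse[OF prim_w])
  also have "(- 1) ^ r * w powi (triangular (int r)) = z powi (((int n)\<^sup>2 - 1) div 3)"
  proof -
    have "(int n)\<^sup>2 - 1 = 3 * (int r * (3 * int r + 2))"
      by (simp add: assms power2_eq_square algebra_simps)
    then have "((int n)\<^sup>2 - 1) div 3 = int r * (3 * int r + 2)"
      by (simp only: nonzero_mult_div_cancel_left[OF zero_neq_numeral[symmetric]])
    \<comment> \<open>The difference of the exponents is \<open>r n / 2\<close>.\<close>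
    moreover have "z powi (int r * (3 * int r + 2) - 3 * triangular (int r)) = (- 1) powi (int r)"
      using two_triangular[of "int r"] by (intro primitive_root_powi_half[OF prim]) (auto simp: assms algebra_simps)
    ultimately show ?thesis
      using primitive_root_nonzero[OF prim] by (simp add: power_int_diff power_int_mult w_def field_simps)
  qed
  finally have "(\<Sum>s = 1..2 * r. appell_term z (int r - int s)) = of_nat r / 2 * z powi (((int n)\<^sup>2 - 1) div 3)"
    by simp
  moreover have "(\<Sum>m \<in> {- int r..int r - 1}. appell_term z m) = (\<Sum>s = 1..2 * r. appell_term z (int r - int s))"
    by (rule sum.reindex_bij_witness[of _ "\<lambda>s. int r - int s" "\<lambda>m. nat (int r - m)"]) auto
  ultimately show ?thesis by simp
qed

text \<open>The pole is now \<open>3 * m + 1 = - n\<close>, that is \<open>m = - a\<close>, and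
  \<open>m = s - a\<close> gives the denominator \<open>1 - w ^ s\<close> directly. The index
  \<open>s\<close> stops at \<open>2 * a - 1\<close>, one short of the range in
  \<open>sum_theta_quotient\<close>.\<close>

lemma appell_sum_2_mod_3:
  assumes "n + 1 = 3 * a"
  shows "(\<Sum>m \<in> {1 - int a..int a - 1}. appell_term z m)
     = - (of_nat a / 2) * z powi (((int n)\<^sup>2 - 1) div 3)"
proof -
  define w where "w = z ^ 3"
  have n: "int n = 3 * int a - 1" using assms by linarith
  have "a > 0" using assms by auto
  have "coprime n 3"
    using coprime_mult_right_iff[of n 3 a] by (simp flip: assms)
  then have prim_w: "primitive_root_of_unity n w"
    unfolding w_def by (rule primitive_root_power[OF prim])
  have "appell_term z (int s - int a) = ((- 1) ^ a * w powi (triangular (int a - 1))) * (theta_term w a s / (1 - w ^ s))"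
    for s
  proof -
    have "2 * triangular (int s - int a) = 2 * (triangular (int a - 1) + (triangular (int s) - int a * int s))"
      unfolding right_diff_distrib distrib_left two_triangular by (simp add: algebra_simps)
    then have "triangular (int s - int a) = triangular (int a - 1) + (triangular (int s) - int a * int s)"
      by simp
    then have "w powi triangular (int s - int a) = w powi (triangular (int a - 1)) * w powi (triangular (int s) - int a * int s)"
      using primitive_root_nonzero[OF prim_w] by (simp add: power_int_add)
    moreover have "z powi (3 * (int s - int a) + 1) = w ^ s"
    proof -
      have "z powi (3 * (int s - int a) + 1) = z powi (3 * int s)"
        by (rule primitive_root_powi_cong[OF prim], rule dvdI[of _ _ "- 1"]) (simp add: n)
      then show ?thesis
        by (simp add: power_int_mult w_def)
    qed
    moreover have "((- 1) :: 'a) powi (int s - int a) = (- 1) ^ a * (- 1) ^ s"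
      by (simp add: power_int_minus_left minus_one_power_iff)
    ultimately show ?thesis
      unfolding appell_term_def theta_term_def power_int_mult
      by (simp add: w_def[symmetric])
  qed
  then have "(\<Sum>s = 1..2 * a - 1. appell_term z (int s - int a)) =
      ((- 1) ^ a * w powi (triangular (int a - 1))) * (\<Sum>s = 1..2 * a - 1. theta_term w a s / (1 - w ^ s))"
    by (simp add: sum_distrib_left)
  also have "(\<Sum>s = 1..2 * a - 1. theta_term w a s / (1 - w ^ s)) = - (of_nat a / 2)"
  proof (cases "a = 1")
    \<comment> \<open>Here \<open>2 * a = n\<close>, so the term \<open>s = 2 * a\<close> that the
      other case adds and subtracts would have a zero denominator.\<close>
    case True
    then have "n = 2" using assms by simp
    then have "w = - 1" using primitive_root_power_order[OF prim_w] primitive_root_power_neq_1[OF prim_w, of 1] by (simp add: power2_eq_1_iff)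
    then show ?thesis
      using True by (simp add: theta_term_def triangular_def)
  next
    case False
    then have "2 * a < n" using \<open>a > 0\<close> assms by linarith
    let ?h = "\<lambda>j. 1 / (1 - w ^ j)"
    obtain b where b: "2 * a = Suc b" using \<open>a > 0\<close> by (cases "2 * a") auto
    have "(\<Sum>s = 1..2 * a - 1. theta_term w a s / (1 - w ^ s))
        = (\<Sum>s = 1..2 * a. theta_term w a s / (1 - w ^ s)) - theta_term w a (2 * a) / (1 - w ^ (2 * a))"
      unfolding b by simp
    \<comment> \<open>Removing the last term turns the window \<open>a + 1..2 * a\<close> into
      \<open>a..2 * a - 1\<close>, whose ends add up to \<open>n\<close>.\<close>
    also have "theta_term w a (2 * a) / (1 - w ^ (2 * a)) = ?h a - ?h (2 * a)"
      unfolding theta_term_last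
      using primitive_root_power_neq_1[OF prim_w, of "2 * a"] \<open>2 * a < n\<close> \<open>a > 0\<close> by (intro geometric_split) auto
    also have "(\<Sum>s = 1..2 * a. theta_term w a s / (1 - w ^ s)) = - (\<Sum>j = a + 1..2 * a. ?h j)"
      using primitive_root_nonzero[OF prim_w] primitive_root_power_neq_1[OF prim_w] \<open>2 * a < n\<close> by (intro sum_theta_quotient) auto
    also have "- (\<Sum>j = a + 1..2 * a. ?h j) - (?h a - ?h (2 * a)) = - (\<Sum>j = a..2 * a. ?h j) + ?h (2 * a)"
      by (simp add: sum.atLeast_Suc_atMost[of a])
    also have "\<dots> = - (\<Sum>j = a..2 * a - 1. ?h j)"
    proof -
      have "a \<le> Suc b" using b by linarith
      then show ?thesis unfolding b by simp
    qed
    also have "(\<Sum>j = a..2 * a - 1. ?h j) = of_nat (card {a..2 * a - 1}) / 2"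
      using \<open>a > 0\<close> \<open>2 * a < n\<close> assms by (intro primitive_root_sum_inverse[OF prim_w]) auto
    also have "card {a..2 * a - 1} = a" using \<open>a > 0\<close> by simp
    finally show ?thesis .
  qed
  also have "(- 1) ^ a * w powi (triangular (int a - 1)) = z powi (((int n)\<^sup>2 - 1) div 3)"
  proof -
    have "(int n)\<^sup>2 - 1 = 3 * (int a * (3 * int a - 2))"
      by (simp add: n power2_eq_square algebra_simps)
    then have "((int n)\<^sup>2 - 1) div 3 = int a * (3 * int a - 2)" by simp
    \<comment> \<open>The difference of the exponents is \<open>a n / 2\<close>.\<close>
    moreover have "z powi (int a * (3 * int a - 2) - 3 * triangular (int a - 1)) = (- 1) powi (int a)"
    proof (rule primitive_root_powi_half[OF prim])
      show "odd (int a) \<longleftrightarrow> even n"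
        using n by presburger
      show "2 * (int a * (3 * int a - 2) - 3 * triangular (int a - 1)) = int a * int n"
        using two_triangular[of "int a - 1"] by (simp add: n algebra_simps)
    qed
    moreover have "w powi (triangular (int a - 1)) = z powi (3 * triangular (int a - 1))"
      by (simp add: power_int_mult w_def)
    ultimately show ?thesis
      using primitive_root_nonzero[OF prim] by (simp add: power_int_diff nonzero_divide_eq_eq)
  qed
  finally have "(\<Sum>s = 1..2 * a - 1. appell_term z (int s - int a)) = - (of_nat a / 2) * z powi (((int n)\<^sup>2 - 1) div 3)"
    by simp
  moreover have "(\<Sum>m \<in> {1 - int a..int a - 1}. appell_term z m) = (\<Sum>s = 1..2 * a - 1. appell_term z (int s - int a))"
    by (rule sum.reindex_bij_witness[of _ "\<lambda>s. int s - int a" "\<lambda>m. nat (m + int a)"]) auto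
  ultimately show ?thesis by simp
qed

text \<open>In both cases \<open>k\<close> and \<open>m\<close> have opposite parity, whence the
  minus sign. For \<open>m < 0\<close> the exponent has an additional \<open>k\<close>, and
  \<open>z ^ k / (1 - z ^ k) = - 1 / (1 - 1 / z ^ k)\<close> absorbs the Legendre symbol
  \<open>- 1\<close>.\<close>

lemma legendre_term_eq:
  fixes k :: nat
  assumes k: "0 < k" "k < n" "int k = \<bar>3 * m + 1\<bar>"
  shows "of_int (Legendre (int k) 3) * ((- 1) ^ k / ((1 - z ^ k) / (1 - z))) * z powi q_exponent (int k)
     = - (1 - z) * appell_term z m"
proof (cases "m \<ge> 0")
  case True
  then have k': "int k = 3 * m + 1" using k by simp
  have L: "Legendre (int k) 3 = 1" by (simp add: Legendre_3 k')
  have "\<not> 3 dvd int k" unfolding k' by presburger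
  from q_exponent_exact[OF this] have "rat_of_int (6 * q_exponent (int k))
      = of_int (2 * (int k * (int k - 1)) - (int k - 1) * (int k - 2))"
    unfolding L by simp
  then have "6 * q_exponent (int k) = 2 * (int k * (int k - 1)) - (int k - 1) * (int k - 2)"
    by (simp only: of_int_eq_iff)
  also have "\<dots> = 9 * (m * (m + 1))" unfolding k' by (simp add: algebra_simps)
  finally have "q_exponent (int k) = 3 * triangular m"
    unfolding two_triangular[symmetric] by simp
  moreover have "z powi (3 * m + 1) = z ^ k" using k' by (metis power_int_of_nat)
  moreover have "((- 1) :: 'a) ^ k = - ((- 1) powi m)"
  proof -
    have "even k \<longleftrightarrow> odd m" using k' by presburger
    then show ?thesis by (simp add: minus_one_power_iff power_int_minus_left)
  qed
  ultimately show ?thesis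
    unfolding appell_term_def L by (simp add: divide_simps) (simp add: algebra_simps)
next
  case False
  then have k': "int k = - 3 * m - 1" using k by simp
  have "int k mod 3 = 2" unfolding k' by presburger
  then have L: "Legendre (int k) 3 = - 1" by (simp add: Legendre_3)
  have "\<not> 3 dvd int k" unfolding k' by presburger
  from q_exponent_exact[OF this] have "rat_of_int (6 * q_exponent (int k))
      = of_int (2 * (int k * (int k + 1)) - (int k - 1) * (int k - 2))"
    unfolding L by simp
  then have "6 * q_exponent (int k) = 2 * (int k * (int k + 1)) - (int k - 1) * (int k - 2)"
    by (simp only: of_int_eq_iff)
  also have "\<dots> = 9 * (m * (m + 1)) + 6 * int k" unfolding k' by (simp add: algebra_simps)
  finally have e: "q_exponent (int k) = 3 * triangular m + int k"
    unfolding two_triangular[symmetric] by simp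
  have "z powi (3 * m + 1) = z powi (- int k)" using k' by (intro arg_cong[of _ _ "\<lambda>e. z powi e"]) simp
  then have d: "z powi (3 * m + 1) = 1 / z ^ k" by (simp add: power_int_minus_divide)
  have s: "((- 1) :: 'a) ^ k = - ((- 1) powi m)"
  proof -
    have "even k \<longleftrightarrow> odd m" using k' by presburger
    then show ?thesis by (simp add: minus_one_power_iff power_int_minus_left)
  qed
  have nz: "z ^ k \<noteq> 0" "z ^ k \<noteq> 1" using primitive_root_nonzero[OF prim] primitive_root_power_neq_1[OF prim] k by auto
  have "appell_term z m = ((- 1) powi m * z powi (3 * triangular m) * z ^ k) / z ^ k / (1 - 1 / z ^ k)"
    unfolding appell_term_def d using nz by simp
  also have "\<dots> = - ((- 1) powi m * z powi (3 * triangular m) * z ^ k / (1 - z ^ k))"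
    using nz by (intro divide_one_minus_inverse)
  finally have a: "appell_term z m = - ((- 1) powi m * z powi (3 * triangular m) * z ^ k / (1 - z ^ k))" .
  show ?thesis
    unfolding e L s a using primitive_root_nonzero[OF prim] by (simp add: power_int_add divide_simps) (simp add: algebra_simps)
qed

text \<open>The Legendre symbol unifies the three cases: the coefficient on the right is 0 for
  \<open>n = 3 * d\<close>, \<open>(1 - n) / 6 = - r / 2\<close> for \<open>n = 3 * r + 1\<close>,
  and \<open>(1 + n) / 6 = a / 2\<close> for \<open>n = 3 * a - 1\<close>.\<close>

lemma appell_sum:
  "- (\<Sum>m | \<bar>3 * m + 1\<bar> < int n. appell_term z m)
     = of_int (Legendre (int n) 3) * (of_int (Legendre (int n) 3 - int n) / 6) * z powi (((int n)\<^sup>2 - 1) div 3)"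
proof -
  consider d where "n = 3 * d" | r where "n = 3 * r + 1" | a where "n + 1 = 3 * a"
  proof -
    have "n = 3 * (n div 3) \<or> n = 3 * (n div 3) + 1 \<or> n + 1 = 3 * (n div 3 + 1)" by presburger
    then show thesis using that by blast
  qed
  then show ?thesis
  proof cases
    case 1
    then have "{m. \<bar>3 * m + 1\<bar> < int n} = {- int d..int d - 1}" by auto
    moreover have "Legendre (int n) 3 = 0" unfolding Legendre_3 using 1 by simp
    ultimately show ?thesis using appell_sum_0_mod_3[OF 1] by simp
  next
    case 2
    then have "{m. \<bar>3 * m + 1\<bar> < int n} = {- int r..int r - 1}" by auto
    moreover have "Legendre (int n) 3 = 1" unfolding Legendre_3 using 2 by simp
    ultimately show ?thesis using appell_sum_1_mod_3[OF 2] by (simp add: 2)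
  next
    case 3
    then have n: "int n = 3 * int a - 1" by linarith
    then have "{m. \<bar>3 * m + 1\<bar> < int n} = {1 - int a..int a - 1}" by auto
    moreover have "int n mod 3 = 2" unfolding n by presburger
    then have "Legendre (int n) 3 = - 1" unfolding Legendre_3 by simp
    moreover have "of_int (- 1 - int n) = (- 3 * of_nat a :: 'a)"
      unfolding n by simp
    ultimately show ?thesis using appell_sum_2_mod_3[OF 3] by simp
  qed
qed

lemma legendre_sum:
  "(\<Sum>k = 1..n - 1. of_int (Legendre (int k) 3) * ((- 1) ^ k / ((1 - z ^ k) / (1 - z))) * z powi q_exponent (int k))
     = of_int (Legendre (int n) 3) * (of_int (Legendre (int n) 3 - int n) / 6)
         * z powi (((int n)\<^sup>2 - 1) div 3) * (1 - z)"
    (is "sum ?f _ = _")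
proof -
  have "sum ?f {1..n - 1} = sum ?f {k \<in> {1..n - 1}. \<not> 3 dvd k}"
    by (rule sum.mono_neutral_right) (auto simp: Legendre_3)
  also have "\<dots> = (\<Sum>m | \<bar>3 * m + 1\<bar> < int n. - (1 - z) * appell_term z m)"
  proof -
    have "?f (nat \<bar>3 * m + 1\<bar>) = - (1 - z) * appell_term z m" if "\<bar>3 * m + 1\<bar> < int n" for m
    proof (rule legendre_term_eq)
      have "nat \<bar>3 * m + 1\<bar> \<in> {k \<in> {1..n - 1}. \<not> 3 dvd k}"
        using bij_betwE[OF bij_betw_nat_abs_3m_1] that by blast
      then show "0 < nat \<bar>3 * m + 1\<bar>" "nat \<bar>3 * m + 1\<bar> < n" by auto
    qed simp
    then have "(\<Sum>m | \<bar>3 * m + 1\<bar> < int n. - (1 - z) * appell_term z m)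
        = (\<Sum>m | \<bar>3 * m + 1\<bar> < int n. ?f (nat \<bar>3 * m + 1\<bar>))"
      by simp
    also have "\<dots> = sum ?f {k \<in> {1..n - 1}. \<not> 3 dvd k}"
      by (rule sum.reindex_bij_betw[OF bij_betw_nat_abs_3m_1])
    finally show ?thesis by (rule sym)
  qed
  also have "\<dots> = (1 - z) * - (\<Sum>m | \<bar>3 * m + 1\<bar> < int n. appell_term z m)"
    by (simp only: sum_distrib_left sum_negf mult_minus_left mult_minus_right)
  finally show ?thesis unfolding appell_sum by (simp only: mult_ac)
qed

end

section \<open>Evaluation of rational functions at complex points\<close>

definition poly_at :: "rat poly \<Rightarrow> complex \<Rightarrow> complex" where
  "poly_at p z = poly (map_poly of_rat p) z"

lemma poly_at_add: "poly_at (p + q) z = poly_at p z + poly_at q z"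
  by (simp add: poly_at_def map_poly_of_rat_add)

lemma poly_at_mult: "poly_at (p * q) z = poly_at p z * poly_at q z"
  by (simp add: poly_at_def map_poly_of_rat_mult)

lemma poly_at_0 [simp]: "poly_at 0 z = 0"
  by (simp add: poly_at_def)

lemma poly_at_1 [simp]: "poly_at 1 z = 1"
  by (simp add: poly_at_def one_pCons map_poly_pCons)

lemma poly_at_minus: "poly_at (- p) z = - poly_at p z"
  using poly_at_add[of p "- p" z] by (simp add: eq_neg_iff_add_eq_0 add.commute)

text \<open>Evaluation is partial, hence a relation. Any fraction representing \<open>A\<close> may
  witness it, not only the reduced one, which makes closure under the field operations easy.\<close>

definition has_value :: "rat poly fract \<Rightarrow> complex \<Rightarrow> complex \<Rightarrow> bool" where
  "has_value A z v \<longleftrightarrow> (\<exists>a b. A = Fract a b \<and> poly_at b z \<noteq> 0 \<and> v = poly_at a z / poly_at b z)"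

lemma has_valueI: "A = Fract a b \<Longrightarrow> poly_at b z \<noteq> 0 \<Longrightarrow> v = poly_at a z / poly_at b z \<Longrightarrow> has_value A z v"
  unfolding has_value_def by blast

lemma has_value_q_var: "has_value q_var z z"
  by (rule has_valueI[where a = "[:0, 1:]" and b = 1])
     (auto simp: q_var_def poly_at_def map_poly_pCons one_pCons)

lemma has_value_0: "has_value 0 z 0"
  by (rule has_valueI[where a = 0 and b = 1]) (auto simp: Zero_fract_def)

lemma has_value_1: "has_value 1 z 1"
  by (rule has_valueI[where a = 1 and b = 1]) (auto simp: One_fract_def)

lemma has_value_add:
  assumes "has_value A z v" "has_value B z w"
  shows "has_value (A + B) z (v + w)"
proof -
  from assms obtain a b c d where
    "A = Fract a b" "poly_at b z \<noteq> 0" "v = poly_at a z / poly_at b z"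
    "B = Fract c d" "poly_at d z \<noteq> 0" "w = poly_at c z / poly_at d z"
    unfolding has_value_def by blast
  moreover from this have "b \<noteq> 0" "d \<noteq> 0" by auto
  ultimately show ?thesis
    by (intro has_valueI[where a = "a * d + c * b" and b = "b * d"])
       (auto simp: poly_at_add poly_at_mult add_frac_eq)
qed

lemma has_value_uminus:
  assumes "has_value A z v"
  shows "has_value (- A) z (- v)"
proof -
  from assms obtain a b where
    "A = Fract a b" "poly_at b z \<noteq> 0" "v = poly_at a z / poly_at b z"
    unfolding has_value_def by blast
  then show ?thesis
    by (intro has_valueI[where a = "- a" and b = b]) (auto simp: poly_at_minus)
qed

lemma has_value_diff: "has_value A z v \<Longrightarrow> has_value B z w \<Longrightarrow> has_value (A - B) z (v - w)"
  using has_value_add[OF _ has_value_uminus, of A z v B w] by simp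

lemma has_value_mult:
  assumes "has_value A z v" "has_value B z w"
  shows "has_value (A * B) z (v * w)"
proof -
  from assms obtain a b c d where
    "A = Fract a b" "poly_at b z \<noteq> 0" "v = poly_at a z / poly_at b z"
    "B = Fract c d" "poly_at d z \<noteq> 0" "w = poly_at c z / poly_at d z"
    unfolding has_value_def by blast
  then show ?thesis
    by (intro has_valueI[where a = "a * c" and b = "b * d"]) (auto simp: poly_at_mult)
qed

lemma has_value_inverse:
  assumes "has_value A z v" "v \<noteq> 0"
  shows "has_value (inverse A) z (inverse v)"
proof -
  from assms obtain a b where
    "A = Fract a b" "poly_at b z \<noteq> 0" "v = poly_at a z / poly_at b z"
    unfolding has_value_def by blast
  then show ?thesis
    using assms(2) by (intro has_valueI[where a = b and b = a]) auto
qed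

lemma has_value_divide:
  "has_value A z v \<Longrightarrow> has_value B z w \<Longrightarrow> w \<noteq> 0 \<Longrightarrow> has_value (A / B) z (v / w)"
  unfolding divide_inverse by (intro has_value_mult has_value_inverse)

lemma has_value_power: "has_value A z v \<Longrightarrow> has_value (A ^ k) z (v ^ k)"
  by (induction k) (auto intro: has_value_1 has_value_mult)

lemma has_value_powi: "has_value A z v \<Longrightarrow> v \<noteq> 0 \<Longrightarrow> has_value (A powi e) z (v powi e)"
  unfolding power_int_def by (auto intro: has_value_power has_value_inverse)

lemma has_value_of_nat: "has_value (of_nat k) z (of_nat k)"
  by (induction k) (auto intro: has_value_0 has_value_1 has_value_add)

lemma has_value_of_int: "has_value (of_int k) z (of_int k)"
  by (cases k rule: int_cases) (auto intro!: has_value_uminus has_value_of_nat simp del: of_nat_Suc)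

lemma has_value_numeral: "has_value (numeral k) z (numeral k)"
  using has_value_of_nat[of "numeral k" z] by simp

lemma has_value_sum:
  "(\<And>k. k \<in> S \<Longrightarrow> has_value (A k) z (v k)) \<Longrightarrow> has_value (\<Sum>k\<in>S. A k) z (\<Sum>k\<in>S. v k)"
  by (induction S rule: infinite_finite_induct) (auto intro: has_value_0 has_value_add)

text \<open>By coprimality the reduced denominator divides every other denominator of
  \<open>A\<close>, so it inherits nonvanishing at \<open>z\<close>.\<close>

lemma has_value_quot_of_fract:
  assumes "has_value A z v"
  shows "poly_at (snd (quot_of_fract A)) z \<noteq> 0"
    and "poly_at (fst (quot_of_fract A)) z = v * poly_at (snd (quot_of_fract A)) z"
proof -
  define p q where "p = fst (quot_of_fract A)" and "q = snd (quot_of_fract A)"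
  from assms obtain a b where A: "A = Fract a b" "poly_at b z \<noteq> 0" "v = poly_at a z / poly_at b z"
    unfolding has_value_def by blast
  have "b \<noteq> 0" using A by auto
  have "q \<noteq> 0" by (simp add: q_def)
  have "Fract p q = Fract a b" using A by (simp add: p_def q_def)
  then have eq: "p * b = a * q" using \<open>b \<noteq> 0\<close> \<open>q \<noteq> 0\<close> by (simp add: eq_fract)
  have "coprime q p"
    unfolding p_def q_def using coprime_quot_of_fract by (simp add: coprime_commute)
  moreover have "q dvd p * b" unfolding eq by simp
  ultimately have "q dvd b" by (simp add: coprime_dvd_mult_right_iff)
  then show nz: "poly_at (snd (quot_of_fract A)) z \<noteq> 0"
    using A(2) by (auto simp: poly_at_mult q_def[symmetric] elim!: dvdE)
  have "poly_at p z * poly_at b z = poly_at a z * poly_at q z"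
    using eq by (metis poly_at_mult)
  then show "poly_at (fst (quot_of_fract A)) z = v * poly_at (snd (quot_of_fract A)) z"
    unfolding p_def[symmetric] q_def[symmetric] A(3) using A(2) by (simp add: field_simps)
qed

section \<open>From values at roots to divisibility by the cyclotomic polynomial\<close>

lemma cis_root_of_unity_power_eq_1:
  assumes "n > 0"
  shows "cis (2 * pi * real k / real n) ^ j = 1 \<longleftrightarrow> n dvd k * j"
proof -
  let ?f = "\<lambda>k. cis (2 * pi * real k / real n)"
  let ?m = "k * j mod n"
  have inj: "inj_on ?f {..<n}"
    using bij_betw_roots_unity[OF assms] by (simp add: bij_betw_def)
  have n1: "?f i ^ n = 1" for i
    using bij_betw_roots_unity[OF assms] assms by (simp add: Complex.DeMoivre)
  have pow: "?f 1 ^ i = ?f i" for i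
    by (simp add: Complex.DeMoivre mult_ac)
  have "?f k ^ j = ?f 1 ^ (k * j)"
    by (simp only: power_mult pow)
  also have "\<dots> = ?f 1 ^ (n * (k * j div n) + ?m)" by simp
  also have "\<dots> = ?f ?m"
    unfolding power_add power_mult n1 by (simp only: pow power_one mult_1)
  finally have "?f k ^ j = 1 \<longleftrightarrow> ?f ?m = ?f 0" by simp
  also have "\<dots> \<longleftrightarrow> ?m = 0"
    using inj_onD[OF inj, of ?m 0] assms by auto
  finally show ?thesis by (simp add: dvd_eq_mod_eq_0)
qed

lemma poly_complex_cyclotomic_eq_0:
  assumes "n > 0" "poly (complex_cyclotomic n) z = 0"
  shows "primitive_root_of_unity n z"
proof -
  from assms obtain k where k: "coprime n k" "z = cis (2 * pi * real k / real n)"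
    unfolding complex_cyclotomic_def exp_root_of_unity
    by (auto simp: poly_prod)
  show ?thesis
    unfolding primitive_root_of_unity_def
  proof (intro conjI allI impI)
    show "z ^ n = 1" unfolding k(2) cis_root_of_unity_power_eq_1[OF assms(1)] by simp
    show "z ^ j \<noteq> 1" if "0 < j" "j < n" for j
      unfolding k(2) cis_root_of_unity_power_eq_1[OF assms(1)]
      using that k(1) by (metis coprime_dvd_mult_right_iff nat_dvd_not_less)
  qed (rule assms(1))
qed

lemma prod_linear_factors_dvd:
  fixes p :: "'a :: idom poly"
  assumes "finite S" "\<And>x. x \<in> S \<Longrightarrow> poly p x = 0"
  shows "(\<Prod>x\<in>S. [:- x, 1:]) dvd p"
  using assms
proof (induction S arbitrary: p rule: finite_induct)
  case (insert x S)
  then obtain q where p: "p = [:- x, 1:] * q"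
    by (metis insertI1 poly_eq_0_iff_dvd dvdE)
  have "poly q y = 0" if "y \<in> S" for y
    using insert.prems[of y] insert.hyps that by (auto simp: p)
  then show ?case
    unfolding p prod.insert[OF insert.hyps] by (intro mult_dvd_mono insert.IH) auto
qed simp

text \<open>The roots are simple: distinct \<open>k\<close> in \<open>{1..n}\<close> give distinct
  \<open>n\<close>-th roots of unity, so the product over \<open>k\<close> is one over a set of
  roots.\<close>

lemma complex_cyclotomic_dvd:
  assumes "n > 0" "\<And>z. poly (complex_cyclotomic n) z = 0 \<Longrightarrow> poly p z = 0"
  shows "complex_cyclotomic n dvd p"
proof -
  let ?f = "\<lambda>k. cis (2 * pi * real k / real n)"
  let ?K = "{k. k \<in> {1..n} \<and> coprime n k}"
  have pow: "?f 1 ^ k = ?f k" for k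
    by (simp add: Complex.DeMoivre mult_ac)
  have neq: "?f k \<noteq> ?f l" if "k < l" "k \<in> {1..n}" "l \<in> {1..n}" for k l
  proof
    assume "?f k = ?f l"
    then have "?f 1 ^ k = ?f 1 ^ l" by (simp only: pow)
    also have "l = k + (l - k)" using \<open>k < l\<close> by simp
    finally have "?f 1 ^ k = ?f 1 ^ k * ?f 1 ^ (l - k)" by (simp only: power_add)
    then have "?f 1 ^ (l - k) = 1" by simp
    then have "n dvd l - k"
      by (simp only: cis_root_of_unity_power_eq_1[OF assms(1)] mult_1)
    then show False using that by (auto dest!: dvd_imp_le)
  qed
  have "inj_on ?f ?K"
    by (rule linorder_inj_onI') (use neq in auto)
  then have *: "complex_cyclotomic n = (\<Prod>x\<in>?f ` ?K. [:- x, 1:])"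
    unfolding complex_cyclotomic_def exp_root_of_unity by (simp add: prod.reindex)
  show ?thesis
    unfolding * by (rule prod_linear_factors_dvd) (auto intro!: assms(2) simp: * poly_prod)
qed

text \<open>Divisibility descends from complex to rational coefficients by degree: the remainder of
  \<open>p\<close> vanishes at all the roots, so it would be a multiple of the complex polynomial if
  it were nonzero.\<close>

lemma cyclotomic_dvd:
  assumes "n > 0" "\<And>z. poly (complex_cyclotomic n) z = 0 \<Longrightarrow> poly_at p z = 0"
  shows "cyclotomic n dvd p"
proof (cases "p mod cyclotomic n = 0")
  case False
  let ?m = "map_poly of_rat :: rat poly \<Rightarrow> complex poly" and ?C = "cyclotomic n"
  note C = map_poly_of_rat_cyclotomic[OF assms(1)]
  have deg: "degree (?m q) = degree q" for q
    by (rule degree_map_poly) auto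
  have "?C \<noteq> 0" using C complex_cyclotomic_nonzero[of n] by auto
  have "poly_at (p mod ?C) z = 0" if "poly (complex_cyclotomic n) z = 0" for z
  proof -
    have "poly_at p z = poly_at (p div ?C * ?C + p mod ?C) z" by simp
    then show ?thesis
      unfolding poly_at_add poly_at_mult using that assms(2) by (simp add: poly_at_def C)
  qed
  then have "complex_cyclotomic n dvd ?m (p mod ?C)"
    using assms(1) by (intro complex_cyclotomic_dvd) (auto simp: poly_at_def)
  moreover have "?m (p mod ?C) \<noteq> 0"
    using False map_poly_of_rat_eq_iff[of "p mod ?C" 0] by simp
  ultimately have "degree ?C \<le> degree (p mod ?C)"
    using dvd_imp_degree_le[of "complex_cyclotomic n" "?m (p mod ?C)"] by (simp add: deg flip: C)
  then show ?thesis
    using degree_mod_less[OF \<open>?C \<noteq> 0\<close>, of p] False by simp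
qed (simp add: mod_eq_0_iff_dvd)

text \<open>A common divisor has no complex root, hence is constant by the fundamental theorem of
  algebra.\<close>

lemma coprime_cyclotomic:
  assumes "n > 0" "\<And>z. poly (complex_cyclotomic n) z = 0 \<Longrightarrow> poly_at q z \<noteq> 0"
  shows "coprime q (cyclotomic n)"
proof (rule coprimeI)
  fix d assume d: "d dvd q" "d dvd cyclotomic n"
  let ?m = "map_poly of_rat :: rat poly \<Rightarrow> complex poly"
  note C = map_poly_of_rat_cyclotomic[OF assms(1)]
  have "poly (?m d) z \<noteq> 0" for z
  proof
    assume "poly (?m d) z = 0"
    then have "poly_at d z = 0" by (simp add: poly_at_def)
    then have "poly_at q z = 0" "poly_at (cyclotomic n) z = 0"
      using d by (auto elim!: dvdE simp: poly_at_mult)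
    then show False using assms(2)[of z] by (simp add: poly_at_def C)
  qed
  then have "constant (poly (?m d))"
    using fundamental_theorem_of_algebra by blast
  then have "degree (?m d) = 0" by (simp add: constant_degree)
  moreover have "degree (?m d) = degree d" by (rule degree_map_poly) auto
  ultimately have "degree d = 0" by simp
  moreover have "d \<noteq> 0" using \<open>\<And>z. poly (?m d) z \<noteq> 0\<close>[of 0] by auto
  ultimately show "is_unit d" by (simp add: is_unit_iff_degree)
qed

text \<open>Reduces the congruence to pointwise identities: having values excludes poles at the
  primitive roots, and their agreement makes the numerator of the difference vanish there.\<close>

lemma cong_fract_cyclotomicI:
  assumes "n > 0"
    and "\<And>z. primitive_root_of_unity n z \<Longrightarrow> has_value A z (v z)"
    and "\<And>z. primitive_root_of_unity n z \<Longrightarrow> has_value B z (v z)"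
  shows "cong_fract A B (cyclotomic n)"
  unfolding cong_fract_def
proof (intro conjI coprime_cyclotomic[OF assms(1)] cyclotomic_dvd[OF assms(1)])
  fix z assume "poly (complex_cyclotomic n) z = 0"
  then have "primitive_root_of_unity n z" by (rule poly_complex_cyclotomic_eq_0[OF assms(1)])
  note A = assms(2)[OF this] and B = assms(3)[OF this]
  show "poly_at (snd (quot_of_fract A)) z \<noteq> 0"
    by (rule has_value_quot_of_fract(1)[OF A])
  show "poly_at (snd (quot_of_fract B)) z \<noteq> 0"
    by (rule has_value_quot_of_fract(1)[OF B])
  show "poly_at (fst (quot_of_fract (A - B))) z = 0"
    using has_value_quot_of_fract(2)[OF has_value_diff[OF A B]] by simp
qed

section \<open>Values of the two sides of the congruence\<close>

lemmas has_value_intros = has_value_mult has_value_divide has_value_diff has_value_power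
  has_value_powi has_value_of_int has_value_numeral has_value_uminus has_value_1 has_value_q_var

lemma has_value_legendre_sum:
  assumes prim: "primitive_root_of_unity n z"
  shows "has_value (\<Sum>k = 1..n - 1. of_int (Legendre (int k) 3) * ((- 1) ^ k / q_int k)
              * q_var powi q_exponent (int k)) z
          (of_int (Legendre (int n) 3) * (of_int (Legendre (int n) 3 - int n) / 6)
              * z powi (((int n)\<^sup>2 - 1) div 3) * (1 - z))"
  unfolding legendre_sum[OF prim, symmetric] q_int_def
proof (intro has_value_sum has_value_intros)
  fix k assume "k \<in> {1..n - 1}"
  then have "0 < k" "k < n" by auto
  \<comment> \<open>For \<open>n = 1\<close>, where \<open>z = 1\<close>, the index range is empty;
    an actual index therefore ensures \<open>1 - z \<noteq> 0\<close>.\<close>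
  moreover from this have "1 < n" by linarith
  ultimately have "z ^ k \<noteq> 1" "z ^ 1 \<noteq> 1"
    using primitive_root_power_neq_1[OF prim, of k] primitive_root_power_neq_1[OF prim, of 1] by auto
  then show "1 - z \<noteq> 0" "(1 - z ^ k) / (1 - z) \<noteq> 0" by auto
qed (rule primitive_root_nonzero[OF prim])

text \<open>The \<open>div\<close> in the exponent is exact when 3 does not divide \<open>n\<close>;
  otherwise the coefficient is 0.\<close>

lemma has_value_legendre_closed_form:
  assumes "primitive_root_of_unity n z"
  shows "has_value (of_int (Legendre (int n) 3) * (of_int (Legendre (int n) 3 - int n) / 6)
              * q_var powi (((int n)\<^sup>2 - 1) div 3) * (1 - q_var)) z
          (of_int (Legendre (int n) 3) * (of_int (Legendre (int n) 3 - int n) / 6)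
              * z powi (((int n)\<^sup>2 - 1) div 3) * (1 - z))"
  using primitive_root_nonzero[OF assms] by (intro has_value_intros) auto

theorem theorem1p1:
  fixes n :: nat
  assumes "n > 0"
  shows "cong_fract
           (\<Sum>k = 1..n - 1. of_int (Legendre (int k) 3) * ((- 1) ^ k / q_int k)
              * q_var powi q_exponent (int k))
           (of_int (Legendre (int n) 3) * (of_int (Legendre (int n) 3 - int n) / 6)
              * q_var powi (((int n)\<^sup>2 - 1) div 3) * (1 - q_var))
           (cyclotomic n)"
  by (rule cong_fract_cyclotomicI[OF assms has_value_legendre_sum has_value_legendre_closed_form])

end
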